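(* Let $m$ be a positive integer. Every positive integer solution $n$ of \[\sigma_2(n)-n^2=L_{2m}\,n-(L_{2m}^2-5)\] with $n>(L_{2m}+L_{2m}^2-5)^3$ is of one of the following forms: (i) $n=L_{2k}L_{2k+2m}$ for some integer $k\ge 0$, where both $L_{2k}$ and $L_{2k+2m}$ are primes; (ii) $n=L_{2k}L_{2m-2k}$ for some integer $k$ with $0\le k\le m$ and $k\neq \frac{m}{2}$, where both $L_{2k}$ and $L_{2m-2k}$ are primes.
   Context: $\sigma_2(n)=\sum_{d\mid n}d^2$. $L_n$ are the Lucas numbers: $L_0=2$, $L_1=1$, $L_n=L_{n-1}+L_{n-2}$. A Lucas prime is a Lucas number that is prime. *)

theory Defs
  imports "HOL-Computational_Algebra.Primes"
begin

definition sigma2 :: "nat \<Rightarrow> nat" where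
  "sigma2 n = (\<Sum>d | d dvd n. d ^ 2)"

fun lucas :: "nat \<Rightarrow> nat" where
  "lucas 0 = 2"
| "lucas (Suc 0) = 1"
| "lucas (Suc (Suc n)) = lucas (Suc n) + lucas n"

end

theory Submission
  imports Defs "HOL-Number_Theory.Fib"
begin

text \<open>
  Write \<open>A\<close> for the Lucas number with index \<open>2m\<close>. If \<open>p\<close> is the least prime factor of \<open>n = p r\<close>,
  then \<open>r\<^sup>2\<close> is one of the summands of \<open>\<sigma>\<^sub>2(n) - n\<^sup>2 < A n\<close>, so \<open>r < A p\<close>. If \<open>r\<close> were composite
  then \<open>r \<ge> p\<^sup>2\<close>, hence \<open>p < A\<close> and \<open>n < A\<^sup>3\<close>, which the size hypothesis forbids. So \<open>n = p q\<close> with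
  primes \<open>p \<noteq> q\<close>, and the equation reads \<open>p\<^sup>2 + q\<^sup>2 + A\<^sup>2 = A p q + 4\<close>. Completing the square,
  \<open>(2 q - A p)\<^sup>2 = (A\<^sup>2 - 4) (p\<^sup>2 - 4)\<close>, where \<open>A\<^sup>2 - 4\<close> is \<open>5\<close> times a square; hence so is
  \<open>p\<^sup>2 - 4\<close>, which by descent on the Pell equation \<open>x\<^sup>2 - 5 t\<^sup>2 = 4\<close> makes \<open>p\<close> a Lucas number of even
  index. The addition formulas then identify \<open>q\<close>.
\<close>

section \<open>Lucas and Fibonacci numbers\<close>

lemma two_lucas_Suc: "2 * lucas (Suc n) = lucas n + 5 * fib n"
  by (induction n rule: lucas.induct) auto

lemma two_fib_Suc: "2 * fib (Suc n) = fib n + lucas n"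
  by (induction n rule: lucas.induct) auto

text \<open>With \<open>\<phi>\<close> the golden ratio,
  \<open>\<phi> ^ a = (lucas a + fib a * sqrt 5) / 2\<close>. This and \<open>two_fib_add\<close>
  are the two components of \<open>\<phi> ^ a * \<phi> ^ b\<close>, doubled to stay in the
  naturals.\<close>

lemma two_lucas_add: "2 * lucas (a + b) = lucas a * lucas b + 5 * fib a * fib b"
  by (induction a rule: lucas.induct) (use two_lucas_Suc[of b] in \<open>auto simp: algebra_simps\<close>)

lemma two_fib_add: "2 * fib (a + b) = fib a * lucas b + lucas a * fib b"
  by (induction a rule: lucas.induct) (use two_fib_Suc[of b] in \<open>auto simp: algebra_simps\<close>)

text \<open>The norm of \<open>\<phi> ^ (2 * k)\<close> is 1: raising \<open>k\<close> by one
  multiplies by \<open>\<phi> ^ 2 = (3 + sqrt 5) / 2\<close>, which has norm 1.\<close>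

lemma lucas_even_Pell: "lucas (2 * k) ^ 2 = 5 * fib (2 * k) ^ 2 + 4"
proof (induction k)
  case (Suc k)
  have "2 * lucas (2 * Suc k) = 3 * lucas (2 * k) + 5 * fib (2 * k)"
    using two_lucas_Suc[of "2 * k"] by simp
  moreover have "2 * fib (2 * Suc k) = lucas (2 * k) + 3 * fib (2 * k)"
    using two_fib_Suc[of "2 * k"] by simp
  ultimately have "(2 * lucas (2 * Suc k)) ^ 2 = 5 * (2 * fib (2 * Suc k)) ^ 2 + 16"
    using Suc by (simp only: power2_eq_square) (simp add: algebra_simps)
  then show ?case by (simp only: power_mult_distrib) simp
qed simp

text \<open>At an even index the conjugate of a power of \<open>\<phi>\<close> is its inverse, so
  the addition formula turns into one for differences.\<close>

lemma two_lucas_diff: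
  assumes "b \<le> a"
  shows "2 * lucas (2 * a - 2 * b) + 5 * fib (2 * a) * fib (2 * b) = lucas (2 * a) * lucas (2 * b)"
proof -
  define c where "c = 2 * a - 2 * b"
  have a: "2 * a = 2 * b + c" using assms by (simp add: c_def)
  have "2 * (lucas (2 * a) * lucas (2 * b)) =
        (lucas (2 * b) * lucas c + 5 * fib (2 * b) * fib c) * lucas (2 * b)"
    unfolding a using two_lucas_add[of "2 * b" c] by (metis mult.assoc)
  also have "\<dots> = lucas c * lucas (2 * b) ^ 2 + 5 * fib (2 * b) * fib c * lucas (2 * b)"
    by (simp add: power2_eq_square algebra_simps)
  also have "\<dots> = 4 * lucas c + 5 * (fib (2 * b) * lucas c + lucas (2 * b) * fib c) * fib (2 * b)"
    unfolding lucas_even_Pell by (simp add: power2_eq_square algebra_simps)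
  also have "\<dots> = 2 * (2 * lucas c + 5 * fib (2 * a) * fib (2 * b))"
    unfolding a two_fib_add[symmetric] by simp
  finally show ?thesis by (simp add: c_def)
qed

text \<open>Descent: dividing \<open>(x + t * sqrt 5) / 2\<close> by \<open>\<phi> ^ 2\<close> gives
  a solution \<open>(y, u)\<close> with \<open>u < t\<close>, until \<open>t = 0\<close>.\<close>

lemma Pell_imp_lucas:
  fixes x t :: nat
  assumes "x ^ 2 = 5 * t ^ 2 + 4"
  shows "\<exists>k. x = lucas (2 * k) \<and> t = fib (2 * k)"
  using assms
proof (induction t arbitrary: x rule: less_induct)
  case (less t)
  show ?case
  proof (cases "t = 0")
    case True
    then have "x ^ 2 = 2 ^ 2" using less.prems by simp
    then have "x = 2" by (simp only: power2_eq_iff_nonneg)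
    with True show ?thesis by (intro exI[of _ 0]) simp
  next
    case False
    then have t1: "1 \<le> t ^ 2" by simp
    have "t ^ 2 < x ^ 2" using less.prems by simp
    then have tx: "t < x" by (rule power_less_imp_less_base) simp
    have "x ^ 2 \<le> (3 * t) ^ 2" using less.prems t1 by (simp add: power_mult_distrib)
    then have x3: "x \<le> 3 * t" by (rule power2_le_imp_le) simp
    have "(5 * t) ^ 2 \<le> (3 * x) ^ 2" using less.prems by (simp add: power_mult_distrib)
    then have t5: "5 * t \<le> 3 * x" by (rule power2_le_imp_le) simp
    \<comment> \<open>Equal parity makes \<open>u = (3 * t - x) / 2\<close> and
      \<open>y = (3 * x - 5 * t) / 2\<close> integers; the bounds above make them
      nonnegative.\<close>
    have "even (x ^ 2) \<longleftrightarrow> even (t ^ 2)" unfolding less.prems by simp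
    then have par: "even x \<longleftrightarrow> even t" by simp
    obtain u where u: "3 * t = x + 2 * u"
      using par x3 by (metis dvd_def even_add even_diff_nat even_mult_iff le_add_diff_inverse odd_numeral)
    obtain y where y: "3 * x = 5 * t + 2 * y"
      using par t5 by (metis dvd_def even_add even_diff_nat even_mult_iff le_add_diff_inverse odd_numeral)
    have "u < t" using u tx by simp
    moreover have "y ^ 2 = 5 * u ^ 2 + 4"
    proof -
      have "2 * int u = 3 * int t - int x" "2 * int y = 3 * int x - 5 * int t"
        using u y by linarith+
      then have "(2 * int y) ^ 2 - 5 * (2 * int u) ^ 2 = 4 * (int x ^ 2 - 5 * int t ^ 2)"
        by (simp only:) (simp add: power2_eq_square algebra_simps)
      moreover have "int x ^ 2 = 5 * int t ^ 2 + 4"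
        using arg_cong[OF less.prems, of int] by simp
      ultimately have "int (y ^ 2) = int (5 * u ^ 2 + 4)" by (simp add: power_mult_distrib)
      then show ?thesis by (simp only: of_nat_eq_iff)
    qed
    ultimately obtain k where k: "y = lucas (2 * k)" "u = fib (2 * k)"
      using less.IH by blast
    have "2 * lucas (2 * Suc k) = 3 * y + 5 * u" "2 * fib (2 * Suc k) = y + 3 * u"
      using two_lucas_Suc[of "2 * k"] two_fib_Suc[of "2 * k"] k by simp_all
    then have "x = lucas (2 * Suc k) \<and> t = fib (2 * Suc k)" using u y by simp
    then show ?thesis by blast
  qed
qed

lemma sum_squares_lucas_imp_lucas:
  fixes x y m :: nat
  assumes m: "0 < m"
    and eq: "x ^ 2 + y ^ 2 + lucas (2 * m) ^ 2 = lucas (2 * m) * x * y + 4"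
  shows "\<exists>k. x = lucas (2 * k) \<and>
           (y = lucas (2 * k + 2 * m) \<or> k \<le> m \<and> y = lucas (2 * m - 2 * k) \<or>
            m \<le> k \<and> y = lucas (2 * k - 2 * m))"
proof -
  define A F where "A = int (lucas (2 * m))" and "F = int (fib (2 * m))"
  \<comment> \<open>As a quadratic equation in \<open>y\<close>, \<open>eqi\<close> below has
    discriminant \<open>s ^ 2\<close>.\<close>
  define s where "s = 2 * int y - A * int x"
  have AF: "A ^ 2 = 5 * F ^ 2 + 4"
    using arg_cong[OF lucas_even_Pell[of m], of int] by (simp add: A_def F_def)
  have F0: "F \<noteq> 0" using m fib_neq_0_nat[of "2 * m"] by (simp add: F_def)
  have eqi: "int x ^ 2 + int y ^ 2 + A ^ 2 = A * int x * int y + 4"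
    using arg_cong[OF eq, of int] by (simp add: A_def)
  have "s ^ 2 = 4 * (int x ^ 2 + int y ^ 2 + A ^ 2 - A * int x * int y) +
                A ^ 2 * int x ^ 2 - 4 * int x ^ 2 - 4 * A ^ 2"
    by (simp add: s_def power2_eq_square algebra_simps)
  also have "\<dots> = (A ^ 2 - 4) * (int x ^ 2 - 4)"
    unfolding eqi by (simp add: algebra_simps)
  also have "\<dots> = 5 * F ^ 2 * (int x ^ 2 - 4)"
    by (simp add: AF)
  finally have s2: "s ^ 2 = 5 * F ^ 2 * (int x ^ 2 - 4)" .
  then have "F ^ 2 dvd s ^ 2" by simp
  then have "F dvd s" by simp
  then obtain w where w: "s = F * w" by blast
  then have w2: "w ^ 2 = 5 * (int x ^ 2 - 4)"
    using s2 F0 by (simp add: power_mult_distrib)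
  then have "5 dvd w ^ 2" by simp
  then have "5 dvd w"
    using prime_dvd_power[of "5 :: int" w 2] by simp
  then obtain t where t: "w = 5 * t" by blast
  have "int x ^ 2 = 5 * t ^ 2 + 4"
    using w2 t by (simp add: power_mult_distrib)
  then have "int (x ^ 2) = int (5 * nat \<bar>t\<bar> ^ 2 + 4)" by simp
  then have "x ^ 2 = 5 * nat \<bar>t\<bar> ^ 2 + 4" by (simp only: of_nat_eq_iff)
  then obtain k where k: "x = lucas (2 * k)" "nat \<bar>t\<bar> = fib (2 * k)"
    using Pell_imp_lucas by blast
  have yt: "2 * int y = A * int x + 5 * F * t"
    using s_def w t by simp
  have "y = lucas (2 * k + 2 * m) \<or> k \<le> m \<and> y = lucas (2 * m - 2 * k) \<or>
        m \<le> k \<and> y = lucas (2 * k - 2 * m)"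
  proof (cases "0 \<le> t")
    case True
    then have "t = int (fib (2 * k))" using k by simp
    then have "int (2 * y) = int (lucas (2 * k) * lucas (2 * m) + 5 * fib (2 * k) * fib (2 * m))"
      using yt by (simp add: A_def F_def k(1))
    then have "2 * y = 2 * lucas (2 * k + 2 * m)"
      unfolding two_lucas_add by (simp only: of_nat_eq_iff)
    then show ?thesis by simp
  next
    case False
    then have "t = - int (fib (2 * k))" using k by simp
    then have "int (2 * y + 5 * fib (2 * m) * fib (2 * k)) = int (lucas (2 * m) * lucas (2 * k))"
      using yt by (simp add: A_def F_def k(1))
    then have "2 * y + 5 * fib (2 * m) * fib (2 * k) = lucas (2 * m) * lucas (2 * k)"
      by (simp only: of_nat_eq_iff)
    then show ?thesis
      using two_lucas_diff[of k m] two_lucas_diff[of m k] nat_le_linear[of k m]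
      by (auto simp: mult.commute mult.left_commute)
  qed
  with k show ?thesis by blast
qed

section \<open>Sums of squares of divisors\<close>

lemma sigma2_ge:
  assumes "0 < n" "d dvd n" "d \<noteq> n"
  shows "n ^ 2 + d ^ 2 \<le> sigma2 n"
proof -
  have "(\<Sum>d\<in>{n, d}. d ^ 2) \<le> sigma2 n"
    unfolding sigma2_def using assms by (intro sum_mono2) auto
  then show ?thesis using assms by simp
qed

lemma divisors_prime_mult_prime:
  fixes p q :: nat
  assumes "prime p" "prime q"
  shows "{d. d dvd p * q} = {1, p, q, p * q}"
proof (intro equalityI subsetI)
  fix d assume "d \<in> {d. d dvd p * q}"
  then obtain a b where ab: "d = a * b" "a dvd p" "b dvd q"
    using division_decomp by blast
  then have "a = 1 \<or> a = p" "b = 1 \<or> b = q"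
    using assms by (auto simp: prime_nat_iff)
  with ab show "d \<in> {1, p, q, p * q}"
    by auto
qed auto

lemma sigma2_prime_mult_prime:
  assumes "prime p" "prime q" "p \<noteq> q"
  shows "sigma2 (p * q) = 1 + p ^ 2 + q ^ 2 + (p * q) ^ 2"
  using assms prime_gt_1_nat[of p] prime_gt_1_nat[of q]
  by (simp add: sigma2_def divisors_prime_mult_prime[OF assms(1,2)])

lemma sigma2_prime_square:
  assumes "prime p"
  shows "sigma2 (p * p) = 1 + p ^ 2 + (p * p) ^ 2"
  using assms prime_gt_1_nat[of p]
  by (simp add: sigma2_def divisors_prime_mult_prime[OF assms assms])

lemma sigma2_prime:
  assumes "prime p"
  shows "sigma2 p = 1 + p ^ 2"
proof -
  have "{d. d dvd p} = {1, p}" using assms by (auto simp: prime_nat_iff)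
  then show ?thesis using prime_gt_1_nat[OF assms] by (simp add: sigma2_def)
qed

text \<open>Only an upper bound on \<open>sigma2 n\<close> is needed to exclude a third prime
  factor, counted with multiplicity.\<close>

lemma eq_mult_primes_if_sigma2_less:
  fixes n A :: nat
  assumes n: "1 < n" "\<not> prime n" and less: "sigma2 n < n ^ 2 + A * n" and A: "A ^ 3 \<le> n"
  shows "\<exists>p q. prime p \<and> prime q \<and> n = p * q"
proof -
  define p where "p = (LEAST p. prime p \<and> p dvd n)"
  have "\<exists>p. prime p \<and> p dvd n" using n prime_factor_nat[of n] by auto
  then have p: "prime p" "p dvd n" unfolding p_def by (metis (mono_tags, lifting) LeastI)+
  have p_le: "p \<le> q" if "prime q" "q dvd n" for q
    unfolding p_def using that by (intro Least_le) simp
  obtain r where r: "n = p * r" using p by blast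
  have "r \<noteq> 1" using r n p by auto
  have "0 < r" using r n by (cases r) auto
  have "prime r"
  proof (rule ccontr)
    assume nr: "\<not> prime r"
    obtain q where q: "prime q" "q dvd r" using prime_factor_nat[OF \<open>r \<noteq> 1\<close>] by blast
    then obtain s where s: "r = q * s" by blast
    \<comment> \<open>A composite \<open>r\<close> splits as \<open>q * s\<close> with both factors
      at least \<open>p\<close>, since \<open>s\<close> also has a prime factor.\<close>
    have "s \<noteq> 1" using s q nr by auto
    then obtain q' where q': "prime q'" "q' dvd s" using prime_factor_nat by blast
    have "0 < s" using s \<open>0 < r\<close> by (cases s) auto
    have "p \<le> q" using p_le q r by auto
    moreover have "p \<le> s"
      using p_le[of q'] q' r s dvd_imp_le[OF q'(2) \<open>0 < s\<close>] by fastforce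
    ultimately have pr: "p * p \<le> r" unfolding s by (rule mult_le_mono)
    have "r \<noteq> n" using r prime_gt_1_nat[OF p(1)] \<open>0 < r\<close> by simp
    then have "n ^ 2 + r ^ 2 \<le> sigma2 n"
      using prime_gt_0_nat[OF p(1)] by (intro sigma2_ge) (auto simp: r \<open>0 < r\<close>)
    then have "r ^ 2 < A * n" using less by linarith
    then have "r * r < (A * p) * r" unfolding r power2_eq_square by (simp only: mult.assoc)
    then have rA: "r < A * p" by simp
    have "p * p < A * p" using pr rA by (rule le_less_trans)
    then have "p < A" by simp
    have "n < A * p * p"
      using rA r prime_gt_0_nat[OF p(1)] by (simp add: mult.commute)
    also have "\<dots> \<le> A * A * A"
      using \<open>p < A\<close> by (intro mult_le_mono) auto
    finally show False using A by (simp add: power3_eq_cube)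
  qed
  then show ?thesis using p r by blast
qed

theorem theorem1p5:
  fixes m n :: nat
  assumes "m > 0" and "n > 0"
    and "int (sigma2 n) - int n ^ 2 =
           int (lucas (2 * m)) * int n - (int (lucas (2 * m)) ^ 2 - 5)"
    and "int n > (int (lucas (2 * m)) + int (lucas (2 * m)) ^ 2 - 5) ^ 3"
  shows "(\<exists>k. n = lucas (2 * k) * lucas (2 * k + 2 * m) \<and>
              prime (lucas (2 * k)) \<and> prime (lucas (2 * k + 2 * m))) \<or>
         (\<exists>k. k \<le> m \<and> 2 * k \<noteq> m \<and>
              n = lucas (2 * k) * lucas (2 * m - 2 * k) \<and>
              prime (lucas (2 * k)) \<and> prime (lucas (2 * m - 2 * k)))"
proof -
  define A where "A = lucas (2 * m)"
  have eq: "int (sigma2 n) + int A ^ 2 = int n ^ 2 + int A * int n + 5"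
    using assms(3) by (simp add: A_def)
  have "5 \<le> 5 * fib (2 * m) ^ 2" using \<open>m > 0\<close> fib_neq_0_nat[of "2 * m"] by simp
  then have "3 ^ 2 \<le> A ^ 2" unfolding A_def lucas_even_Pell by simp
  then have A3: "3 \<le> A" by (rule power2_le_imp_le) simp
  have A9: "9 \<le> int A ^ 2" using power_mono[of 3 "int A" 2] A3 by simp
  define C where "C = int A + int A ^ 2 - 5"
  \<comment> \<open>The cubic size hypothesis thus yields \<open>A ^ 3 < n\<close>, and from here on
    only this is used.\<close>
  have AC: "int A + 4 \<le> C" using A9 by (simp add: C_def)
  have nC: "C ^ 3 < int n" using assms(4) by (simp add: A_def C_def)
  have "int A ^ 3 \<le> C ^ 3" using AC by (intro power_mono) auto
  then have "int A ^ 3 < int n" using nC by linarith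
  then have A3n: "A ^ 3 < n" by (simp flip: of_nat_power)
  have "A ^ 2 \<le> A ^ 3" using A3 by (intro power_increasing) auto
  then have A2n: "A ^ 2 < n" using A3n by simp
  have An: "3 * n \<le> A * n" using A3 by simp
  have eqn: "sigma2 n + A ^ 2 = n ^ 2 + A * n + 5"
    using eq by (simp flip: of_nat_eq_iff[where 'a = int])
  have A9n: "9 \<le> A ^ 2" using \<open>3 ^ 2 \<le> A ^ 2\<close> by simp
  have "1 < n" using A9n A2n by simp
  \<comment> \<open>For \<open>n\<close> prime, and below for \<open>n\<close> the square of a
    prime, the equation fails by size: \<open>A * n \<ge> 3 * n\<close> outweighs
    \<open>A ^ 2 < n\<close>.\<close>
  have "\<not> prime n"
  proof
    assume "prime n"
    then have "1 + A ^ 2 = A * n + 5" using eqn by (simp add: sigma2_prime)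
    with An A2n \<open>1 < n\<close> show False by linarith
  qed
  have "sigma2 n < n ^ 2 + A * n" using eqn A9n by simp
  then obtain p q where pq: "prime p" "prime q" "n = p * q"
    using eq_mult_primes_if_sigma2_less \<open>1 < n\<close> \<open>\<not> prime n\<close> A3n by (meson less_imp_le)
  have "p \<noteq> q"
  proof
    assume "p = q"
    then have "1 + n + A ^ 2 = A * n + 5"
      using eqn pq by (simp add: sigma2_prime_square power2_eq_square)
    with An A2n \<open>1 < n\<close> show False by linarith
  qed
  then have "p ^ 2 + q ^ 2 + A ^ 2 = A * p * q + 4"
    using eqn pq by (simp add: sigma2_prime_mult_prime)
  then obtain k where k: "p = lucas (2 * k)"
    and "q = lucas (2 * k + 2 * m) \<or> k \<le> m \<and> q = lucas (2 * m - 2 * k) \<or>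
         m \<le> k \<and> q = lucas (2 * k - 2 * m)"
    using sum_squares_lucas_imp_lucas[OF \<open>m > 0\<close>]
    unfolding A_def by blast
  then consider "q = lucas (2 * k + 2 * m)" | "k \<le> m" "q = lucas (2 * m - 2 * k)"
    | "m \<le> k" "q = lucas (2 * k - 2 * m)" by blast
  then show ?thesis
  proof cases
    case 1
    with pq k show ?thesis by blast
  next
    case 2
    \<comment> \<open>If \<open>m = 2 * k\<close>, both indices would be \<open>2 * k\<close>,
      forcing \<open>p = q\<close>.\<close>
    have "2 * k \<noteq> m" using 2 k \<open>p \<noteq> q\<close> by auto
    with 2 pq k show ?thesis by blast
  next
    case 3
    \<comment> \<open>This is form (i) again, with \<open>p\<close> and \<open>q\<close>
      exchanged.\<close>
    define j where "j = k - m"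
    have "q = lucas (2 * j)" "p = lucas (2 * j + 2 * m)"
      using 3 k by (simp_all add: j_def diff_mult_distrib2)
    with pq show ?thesis by (metis mult.commute)
  qed
qed

end
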